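(* Let $\mathcal{C}$ be the unit circle centered at the origin of the $xy$-plane in $\mathbb{R}^3$, with constant density $\lambda>0$ and potential $V(\mathbf{r})=-\int_{\mathcal{C}}\frac{\lambda\,du}{\|\mathbf{r}-u\|}$. Let $\mathbf{r}(t)=(x(t),y(t))$ be a maximal solution of $\ddot{\mathbf{r}}=-\nabla V(\mathbf{r})$ contained in the $xy$-plane and inside the circle (that is, $\|\mathbf{r}(t)\|<1$), with angular momentum $K=x\dot y-\dot x y\neq 0$. If $\mathbf{r}(t)$ is normalized, then the trace of the curve $\mathbf{r}(t)$ is the graph of an even convex function $y=y(x)$.
   Context: $du$ denotes arc length on $\mathcal{C}$. For a maximal solution inside the circle in the $xy$-plane with $K\ne 0$ there is a unique time $t_0$ at which $\mathbf{r}(t_0)$ is the point of the trajectory closest to the origin. The solution is called normalized if $\mathbf{r}(t_0)$ lies on the positive $y$-axis. The domain of the function $y(x)$ is an interval symmetric about $0$. *)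

theory Defs
  imports "HOL-Analysis.Analysis"
begin

definition unit_circle :: "(real^3) set" where
  "unit_circle = {u. norm u = 1 \<and> u $ 3 = 0}"

definition circle_param :: "real \<Rightarrow> real^3" where
  "circle_param \<theta> = vector [cos \<theta>, sin \<theta>, 0]"

definition arc_length_integral ::
    "(real \<Rightarrow> 'a::real_normed_vector) \<Rightarrow> real \<Rightarrow> real \<Rightarrow> ('a \<Rightarrow> real) \<Rightarrow> real" where
  "arc_length_integral \<gamma> a b f =
     integral {a..b} (\<lambda>\<theta>. f (\<gamma> \<theta>) * norm (vector_derivative \<gamma> (at \<theta>)))"

(* Only meaningful off the circle: on it the integral diverges and the library
   integral returns 0. *)
definition ring_potential :: "real \<Rightarrow> real^3 \<Rightarrow> real" where
  "ring_potential dens r =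
     - arc_length_integral circle_param 0 (2 * pi) (\<lambda>u. dens / norm (r - u))"

definition velocity :: "(real \<Rightarrow> real^3) \<Rightarrow> real \<Rightarrow> real^3" where
  "velocity r t = vector_derivative r (at t)"

definition angular_momentum :: "(real \<Rightarrow> real^3) \<Rightarrow> real \<Rightarrow> real" where
  "angular_momentum r t = r t $ 1 * velocity r t $ 2 - velocity r t $ 1 * r t $ 2"

(* Values of r outside the time interval I are irrelevant: I is open, so the
   derivatives at points of I depend only on r restricted to I. *)
definition ring_solution :: "real \<Rightarrow> real set \<Rightarrow> (real \<Rightarrow> real^3) \<Rightarrow> bool" where
  "ring_solution dens I r \<longleftrightarrow>
     open I \<and> is_interval I \<and> I \<noteq> {} \<and>
     (\<forall>t\<in>I. r t \<notin> unit_circle \<and> r differentiable (at t) \<and>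
        (\<exists>g. GDERIV (ring_potential dens) (r t) :> g \<and>
             (velocity r has_vector_derivative - g) (at t)))"

definition maximal_ring_solution :: "real \<Rightarrow> real set \<Rightarrow> (real \<Rightarrow> real^3) \<Rightarrow> bool" where
  "maximal_ring_solution dens I r \<longleftrightarrow>
     ring_solution dens I r \<and>
     (\<forall>J s. ring_solution dens J s \<and> I \<subseteq> J \<and> (\<forall>t\<in>I. s t = r t) \<longrightarrow> J = I)"

definition normalized :: "real set \<Rightarrow> (real \<Rightarrow> real^3) \<Rightarrow> bool" where
  "normalized I r \<longleftrightarrow>
     (\<exists>t0. is_arg_min (\<lambda>t. norm (r t)) (\<lambda>t. t \<in> I) t0 \<and>
           r t0 $ 1 = 0 \<and> r t0 $ 2 > 0 \<and> r t0 $ 3 = 0)"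

definition even_on :: "real set \<Rightarrow> (real \<Rightarrow> real) \<Rightarrow> bool" where
  "even_on S f \<longleftrightarrow> (\<forall>x\<in>S. - x \<in> S \<and> f (- x) = f x)"

lemma circle_param_has_vector_derivative:
  "(circle_param has_vector_derivative vector [- sin \<theta>, cos \<theta>, 0]) (at \<theta>)"
proof -
  have eq: "circle_param = (\<lambda>\<theta>. cos \<theta> *\<^sub>R axis 1 1 + sin \<theta> *\<^sub>R axis 2 1)"
    by (auto simp: circle_param_def fun_eq_iff vec_eq_iff forall_3 axis_def)
  have v: "vector [- sin \<theta>, cos \<theta>, 0] =
      ((- sin \<theta>) *\<^sub>R axis 1 1 + cos \<theta> *\<^sub>R axis 2 1 :: real^3)"
    by (auto simp: vec_eq_iff forall_3 axis_def)
  show ?thesis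
    unfolding eq v by (auto intro!: derivative_eq_intros)
qed

lemma norm_vector_3: "norm (u :: real^3) = sqrt ((u$1)\<^sup>2 + (u$2)\<^sup>2 + (u$3)\<^sup>2)"
  by (simp add: norm_vec_def L2_set_def sum_3)

lemma bij_betw_circle_param: "bij_betw circle_param {0..<2 * pi} unit_circle"
  unfolding bij_betw_def
proof
  show "inj_on circle_param {0..<2 * pi}"
  proof (rule inj_onI)
    fix s t assume st: "s \<in> {0..<2 * pi}" "t \<in> {0..<2 * pi}"
      and eq: "circle_param s = circle_param t"
    from eq have "circle_param s $ 1 = circle_param t $ 1" "circle_param s $ 2 = circle_param t $ 2"
      by simp_all
    then have "cos s = cos t" "sin s = sin t"
      by (simp_all add: circle_param_def)
    then have "cis s = cis t" by (simp add: complex_eq_iff)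
    then have "Arg2pi (cis s) = Arg2pi (cis t)" by simp
    moreover have "Arg2pi (cis u) = u" if "u \<in> {0..<2 * pi}" for u
      using that Arg2pi_unique[of 1 u "cis u"] by (simp add: cis_conv_exp)
    ultimately show "s = t" using st by simp
  qed
  show "circle_param ` {0..<2 * pi} = unit_circle"
  proof
    show "circle_param ` {0..<2 * pi} \<subseteq> unit_circle"
      by (auto simp: circle_param_def unit_circle_def norm_vector_3)
    show "unit_circle \<subseteq> circle_param ` {0..<2 * pi}"
    proof
      fix u assume "u \<in> unit_circle"
      then have u: "(u$1)\<^sup>2 + (u$2)\<^sup>2 = 1" "u$3 = 0"
        by (auto simp: unit_circle_def norm_vector_3)
      from u(1) obtain t where "0 \<le> t" "t < 2 * pi" "u$1 = cos t" "u$2 = sin t"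
        using sincos_total_2pi by metis
      with u show "u \<in> circle_param ` {0..<2 * pi}"
        by (intro image_eqI[of _ _ t]) (auto simp: circle_param_def vec_eq_iff forall_3)
    qed
  qed
qed

lemma circle_param_unit_speed: "norm (vector_derivative circle_param (at \<theta>)) = 1"
  by (simp add: vector_derivative_at[OF circle_param_has_vector_derivative] norm_vector_3)

end

theory Submission
  imports Defs
begin

text \<open>
  The potential of the ring is invariant under rotations of the plane, and inside the circle it
  does not increase with the distance from the centre (\<open>ring_force_is_outward\<close>). The force is therefore central
  and repulsive from the origin: \<open>x'' = \<phi> x\<close> and \<open>y'' = \<phi> y\<close> with \<open>\<phi> \<ge> 0\<close>. At the closest point, at
  time \<open>t0\<close>, the position is \<open>(0, y\<^sub>0)\<close> with \<open>y\<^sub>0 > 0\<close> and the velocity is \<open>(v, 0)\<close> with \<open>v \<noteq> 0\<close>.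

  \<^bold>\<open>Convex graph.\<close> Repulsion makes \<open>x'\<^sup>2\<close> and \<open>y\<^sup>2\<close> smallest at \<open>t0\<close>. So \<open>x'\<close> never vanishes and the
  orbit is a graph over the \<open>x\<close>-axis. Its slope \<open>y'/x'\<close> has the derivative
  \<open>\<phi> (y x' - x y') / x'\<^sup>2 = \<phi> y\<^sub>0 v / x'\<^sup>2\<close> by conservation of angular momentum, so it
  does not decrease as \<open>x\<close> increases (\<open>above_tangent\<close>).

  \<^bold>\<open>Symmetry.\<close> Energy and angular momentum determine the radial speed as a function of the
  distance \<open>\<rho>\<close> from the origin. The orbit thus needs the same time from the closest point to a given
  distance in the future as in the past, so \<open>\<rho>\<close> is even about \<open>t0\<close> (\<open>u_even\<close>). The polar angle
  changes at a rate proportional to \<open>1 / \<rho>\<^sup>2\<close>, so it is odd, and the orbit is its own mirror image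
  under time reversal wherever both are defined (\<open>motion_even\<close>). Were the time interval not
  symmetric about \<open>t0\<close>, the mirror image would extend the orbit, contradicting maximality
  (\<open>maximal_imp_symmetric_interval\<close>).
\<close>

section \<open>The potential of the ring inside the circle\<close>

lemma integral_over_period:
  fixes k :: "real \<Rightarrow> real"
  assumes cont: "continuous_on UNIV k" and per: "\<And>\<theta>. k (\<theta> + P) = k \<theta>" and "0 \<le> P"
  shows "integral {a..a+P} k = integral {b..b+P} k"
proof -
  have int: "k integrable_on {c..d}" for c d
    by (meson cont continuous_on_subset integrable_continuous_interval subset_UNIV)
  have *: "integral {a..a+P} k = integral {b..b+P} k" if "a \<le> b" for a b
  proof -
    have "integral {a..b} k + integral {b..b+P} k = integral {a..b+P} k"
      "integral {a..a+P} k + integral {a+P..b+P} k = integral {a..b+P} k"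
      using that \<open>0 \<le> P\<close> int by (auto intro!: Henstock_Kurzweil_Integration.integral_combine)
    moreover have "integral {a+P..b+P} k = integral {a..b} k"
      using integral_shift_Icc_real[of a b k P] by (simp add: o_def per add.commute)
    ultimately show ?thesis by simp
  qed
  show ?thesis using *[of a b] *[of b a] by linarith
qed

text \<open>
  Rotations and reflections of the circle become translations and reflections of the angle,
  which leave the integral over a full period unchanged.
\<close>

lemma integral_circle_rotate_reflect:
  fixes k :: "real \<Rightarrow> real"
  assumes "continuous_on UNIV k" and per: "\<And>\<theta>. k (\<theta> + 2 * pi) = k \<theta>"
  shows "integral {0..2 * pi} (\<lambda>\<theta>. k (\<theta> - a)) = integral {0..2 * pi} k"
    and "integral {0..2 * pi} (\<lambda>\<theta>. k (a - \<theta>)) = integral {0..2 * pi} k"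
proof -
  note period = integral_over_period[OF assms, of _ 0]
  have "integral {0..2 * pi} (\<lambda>\<theta>. k (\<theta> - a)) = integral {-a..-a + 2 * pi} k"
    using integral_shift_Icc_real[of 0 "2*pi" k "-a"] by (simp add: o_def add.commute)
  then show "integral {0..2 * pi} (\<lambda>\<theta>. k (\<theta> - a)) = integral {0..2 * pi} k"
    using period[of "-a"] by simp
  have "integral {0..2 * pi} (\<lambda>\<theta>. k (a - \<theta>)) = integral {-(2 * pi)..0} (\<lambda>\<theta>. k (a + \<theta>))"
    using Henstock_Kurzweil_Integration.integral_reflect_real[of "2*pi" 0 "\<lambda>\<theta>. k (a - \<theta>)"] by simp
  also have "\<dots> = integral {a - 2 * pi..a - 2 * pi + 2 * pi} k"
    using integral_shift_Icc_real[of "-(2*pi)" 0 k a] by (simp add: o_def)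
  finally show "integral {0..2 * pi} (\<lambda>\<theta>. k (a - \<theta>)) = integral {0..2 * pi} k"
    using period[of "a - 2 * pi"] by simp
qed

lemma ring_potential_altdef:
  "ring_potential d p = - integral {0..2 * pi} (\<lambda>\<theta>. d / norm (p - circle_param \<theta>))"
  by (simp add: ring_potential_def arc_length_integral_def circle_param_unit_speed)

lemma norm_diff_circle_param:
  fixes p :: "real^3"
  shows
  "norm (p - circle_param \<theta>) = sqrt ((norm p)\<^sup>2 + 1 - 2 * (p $ 1 * cos \<theta> + p $ 2 * sin \<theta>))"
proof -
  have "(norm p)\<^sup>2 + 1 - 2 * (p $ 1 * cos \<theta> + p $ 2 * sin \<theta>)
      = (p $ 1)\<^sup>2 + (p $ 2)\<^sup>2 + (p $ 3)\<^sup>2 + ((sin \<theta>)\<^sup>2 + (cos \<theta>)\<^sup>2)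
        - 2 * (p $ 1 * cos \<theta> + p $ 2 * sin \<theta>)"
    by (simp add: norm_vector_3)
  also have "\<dots> = (p $ 1 - cos \<theta>)\<^sup>2 + (p $ 2 - sin \<theta>)\<^sup>2 + (p $ 3)\<^sup>2"
    by algebra
  finally show ?thesis
    by (simp add: norm_vector_3 circle_param_def)
qed

lemma circle_param_distance_pos:
  fixes p :: "real^3"
  assumes "norm p < 1"
  shows "0 < (norm p)\<^sup>2 + 1 - 2 * (p $ 1 * cos \<theta> + p $ 2 * sin \<theta>)"
proof -
  have "norm (circle_param \<theta>) = 1"
    by (simp add: norm_vector_3 circle_param_def)
  then have "p \<noteq> circle_param \<theta>" using assms by auto
  then have "0 < norm (p - circle_param \<theta>)" by simp
  then show ?thesis unfolding norm_diff_circle_param by simp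
qed

text \<open>
  In polar coordinates \<open>(\<rho>, a)\<close> the integrand depends on \<open>\<rho>\<close> and \<open>\<theta> - a\<close> only, so \<open>a\<close> drops out
  of the integral over the circle.
\<close>

lemma ring_potential_rotation_invariant:
  assumes "norm p < 1" "norm p' = norm p" "p $ 3 = 0" "p' $ 3 = 0"
  shows "ring_potential d p = ring_potential d p'"
proof -
  define k where "k = (\<lambda>\<theta>. d / sqrt ((norm p)\<^sup>2 + 1 - 2 * (norm p * cos \<theta>)))"
  have *: "ring_potential d q = - integral {0..2 * pi} k"
    if q: "norm q = norm p" "q $ 3 = 0" for q
  proof -
    have rho: "cmod (Complex (q $ 1) (q $ 2)) = norm p"
      using q by (simp add: norm_vector_3 complex_norm)
    define a where "a = Arg (Complex (q $ 1) (q $ 2))"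
    have "rcis (norm p) a = Complex (q $ 1) (q $ 2)"
      unfolding a_def rho[symmetric] by (rule rcis_cmod_Arg)
    then have q12: "q $ 1 = norm p * cos a" "q $ 2 = norm p * sin a"
      by (metis Re_rcis complex.sel(1), metis Im_rcis complex.sel(2))
    have "d / norm (q - circle_param \<theta>) = k (\<theta> - a)" for \<theta>
      by (simp add: norm_diff_circle_param q q12 k_def cos_diff algebra_simps)
    moreover have "integral {0..2 * pi} (\<lambda>\<theta>. k (\<theta> - a)) = integral {0..2 * pi} k"
    proof (rule integral_circle_rotate_reflect)
      have "0 < (norm p)\<^sup>2 + 1 - 2 * (norm p * cos \<theta>)" for \<theta>
        using circle_param_distance_pos[of "vector [norm p, 0, 0]" \<theta>] assms(1)
        by (simp add: norm_vector_3)
      then show "continuous_on UNIV k"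
        unfolding k_def by (intro continuous_intros) (simp add: less_imp_neq[symmetric])
      show "k (\<theta> + 2 * pi) = k \<theta>" for \<theta> by (simp add: k_def)
    qed
    ultimately show ?thesis by (simp add: ring_potential_altdef)
  qed
  show ?thesis using *[of p] *[of p'] assms by simp
qed

text \<open>
  Reflection in the plane \<open>x = 0\<close>. Combined with time reversal it fixes the position
  \<open>(0, y)\<close> and the velocity \<open>(v, 0)\<close> that a normalized orbit has at its closest point, and it
  will turn out to fix the whole orbit.
\<close>

definition mirror :: "real^3 \<Rightarrow> real^3" where
  "mirror p = vector [- p $ 1, p $ 2, p $ 3]"

lemma mirror_nth [simp]:
  "mirror p $ 1 = - p $ 1" "mirror p $ 2 = p $ 2" "mirror p $ 3 = p $ 3"
  by (simp_all add: mirror_def)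

lemma norm_mirror [simp]: "norm (mirror p) = norm p"
  by (simp add: norm_vector_3)

lemma mirror_mirror [simp]: "mirror (mirror p) = p"
  by (simp add: vec_eq_iff forall_3)

lemma mirror_uminus: "mirror (- p) = - mirror p"
  by (simp add: vec_eq_iff forall_3)

lemma inner_mirror: "mirror p \<bullet> q = p \<bullet> mirror q"
  by (simp add: inner_vec_def sum_3)

lemma bounded_linear_mirror: "bounded_linear mirror"
  by (rule bounded_linear_intro[where K = 1])
    (simp_all add: vec_eq_iff forall_3)

lemma mirror_in_unit_circle [simp]: "mirror p \<in> unit_circle \<longleftrightarrow> p \<in> unit_circle"
  by (simp add: unit_circle_def)

text \<open>
  The reflection carries the point of the circle at angle \<open>\<theta>\<close> to the one at \<open>\<pi> - \<theta>\<close>.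
\<close>

lemma ring_potential_mirror:
  assumes "norm p < 1"
  shows "ring_potential d (mirror p) = ring_potential d p"
proof -
  define k where "k = (\<lambda>\<theta>. d / norm (p - circle_param \<theta>))"
  have "d / norm (mirror p - circle_param \<theta>) = k (pi - \<theta>)" for \<theta>
    by (simp only: k_def norm_diff_circle_param) simp
  moreover have "integral {0..2 * pi} (\<lambda>\<theta>. k (pi - \<theta>)) = integral {0..2 * pi} k"
  proof (rule integral_circle_rotate_reflect)
    show "continuous_on UNIV k"
      unfolding k_def norm_diff_circle_param
      using circle_param_distance_pos[OF assms]
      by (intro continuous_intros ballI) (metis real_sqrt_eq_zero_cancel_iff less_irrefl)
    show "k (\<theta> + 2 * pi) = k \<theta>" for \<theta> by (simp add: k_def norm_diff_circle_param)
  qed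
  ultimately show ?thesis by (simp only: ring_potential_altdef k_def)
qed

lemma gderiv_ring_potential_mirror:
  assumes "GDERIV (ring_potential d) p :> g" "norm p < 1"
  shows "GDERIV (ring_potential d) (mirror p) :> mirror g"
proof -
  have "(ring_potential d has_derivative (\<lambda>h. h \<bullet> g)) (at (mirror (mirror p)))"
    using assms by (simp add: gderiv_def)
  then have "((\<lambda>q. ring_potential d (mirror q)) has_derivative (\<lambda>h. mirror h \<bullet> g)) (at (mirror p))"
    by (rule has_derivative_compose[OF bounded_linear_imp_has_derivative[OF bounded_linear_mirror]])
  then have "(ring_potential d has_derivative (\<lambda>h. mirror h \<bullet> g)) (at (mirror p))"
    by (rule has_derivative_transform_within_open[where s = "ball 0 1"])
      (use assms ring_potential_mirror in auto)
  then show ?thesis by (simp add: gderiv_def inner_mirror)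
qed

lemma gderiv_along_curve:
  fixes V :: "'a::real_inner \<Rightarrow> real"
  assumes "GDERIV V (c t) :> g" "(c has_vector_derivative v) (at t)"
  shows "((\<lambda>s. V (c s)) has_real_derivative g \<bullet> v) (at t)"
  using has_derivative_compose[of c "\<lambda>h. h *\<^sub>R v" t UNIV V "\<lambda>h. h \<bullet> g"] assms
  by (simp add: gderiv_def has_vector_derivative_def has_field_derivative_def inner_commute mult.commute[of _ "g \<bullet> v"])

lemma has_vector_derivative_vector_3:
  assumes "(f has_real_derivative f') (at t)" "(g has_real_derivative g') (at t)"
    "(h has_real_derivative h') (at t)"
  shows "((\<lambda>t. vector [f t, g t, h t] :: real^3) has_vector_derivative vector [f', g', h']) (at t)"
proof -
  have eq: "vector [a, b, c] = a *\<^sub>R axis 1 1 + b *\<^sub>R axis 2 1 + c *\<^sub>R (axis 3 1 :: real^3)" for a b c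
    by (auto simp: vec_eq_iff forall_3 axis_def)
  show ?thesis unfolding eq
    using assms by (auto intro!: derivative_eq_intros)
qed

text \<open>
  The potential is constant on the circle through \<open>p\<close> around the origin, so its gradient is
  orthogonal to the tangent \<open>(-p\<^sub>2, p\<^sub>1, 0)\<close> of that circle.
\<close>

lemma ring_force_is_central:
  assumes "GDERIV (ring_potential d) p :> g" "norm p < 1" "p $ 3 = 0"
  shows "g $ 2 * p $ 1 = g $ 1 * p $ 2"
proof -
  define c :: "real \<Rightarrow> real^3" where
    "c = (\<lambda>s. vector [p $ 1 * cos s - p $ 2 * sin s, p $ 2 * cos s + p $ 1 * sin s, 0])"
  have c0: "c 0 = p" using assms by (simp add: c_def vec_eq_iff forall_3)
  have "(c has_vector_derivative vector [- p $ 2, p $ 1, 0]) (at 0)"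
    unfolding c_def
    by (intro has_vector_derivative_vector_3) (auto intro!: derivative_eq_intros)
  then have "((\<lambda>s. ring_potential d (c s)) has_real_derivative g \<bullet> vector [- p $ 2, p $ 1, 0]) (at 0)"
    using assms c0 by (intro gderiv_along_curve) auto
  moreover have "norm (c s) = norm p" for s
  proof -
    have "(p$1 * cos s - p$2 * sin s)\<^sup>2 + (p$2 * cos s + p$1 * sin s)\<^sup>2
        = ((p$1)\<^sup>2 + (p$2)\<^sup>2) * ((sin s)\<^sup>2 + (cos s)\<^sup>2)"
      by algebra
    then show ?thesis using assms by (simp add: c_def norm_vector_3)
  qed
  then have "ring_potential d (c s) = ring_potential d p" for s
    using assms by (intro ring_potential_rotation_invariant[symmetric]) (auto simp: c_def)
  then have "((\<lambda>s. ring_potential d (c s)) has_real_derivative 0) (at 0)" by simp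
  ultimately have "g \<bullet> vector [- p $ 2, p $ 1, 0] = 0" by (rule DERIV_unique)
  then show ?thesis by (simp add: inner_vec_def sum_3)
qed

text \<open>
  The ring attracts a point of the disc towards its nearer side. Put \<open>c = \<langle>p, u(\<theta>)\<rangle>\<close> and
  \<open>D = |p - u(\<theta>)|\<^sup>2 = 1 - 2 c + \<rho>\<^sup>2\<close>. Differentiation of the potential at
  \<open>s p\<close> with respect to \<open>s\<close> under the integral sign shows that the force has the inner product
  \<open>d \<integral> (c - \<rho>\<^sup>2) D powr (-3/2) d\<theta>\<close> with
  \<open>p\<close>. Its integrand changes sign unless \<open>p = 0\<close>. With
  \<open>q = c'\<close>, however, the periodic function \<open>q D powr (-1/2)\<close> has the derivative
  \<open>- (c - \<rho>\<^sup>2) (1 - c) D powr (-3/2)\<close>, which therefore integrates to zero. Since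
  \<open>1 - c = (1 - \<rho>\<^sup>2) - (c - \<rho>\<^sup>2)\<close>, this says
  \<open>(1 - \<rho>\<^sup>2) \<integral> (c - \<rho>\<^sup>2) D powr (-3/2) = \<integral> (c - \<rho>\<^sup>2)\<^sup>2 D powr (-3/2) \<ge> 0\<close>.
\<close>

lemma ring_force_is_outward:
  assumes "GDERIV (ring_potential d) p :> g" "norm p < 1" "p $ 3 = 0" "0 \<le> d"
  shows "g \<bullet> p \<le> 0"
proof -
  define \<rho> where "\<rho> = norm p"
  define c where "c = (\<lambda>\<theta>. p $ 1 * cos \<theta> + p $ 2 * sin \<theta>)"
  define q where "q = (\<lambda>\<theta>. p $ 2 * cos \<theta> - p $ 1 * sin \<theta>)"
  define D where "D = (\<lambda>s \<theta>. (s * \<rho>)\<^sup>2 + 1 - 2 * (s * c \<theta>))"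
  define f where "f = (\<lambda>\<theta>. (c \<theta> - \<rho>\<^sup>2) / (D 1 \<theta> * sqrt (D 1 \<theta>)))"
  define U where "U = {s :: real. \<bar>s\<bar> * \<rho> < 1}"
  have rho: "0 \<le> \<rho>" "\<rho> < 1" using assms by (auto simp: \<rho>_def)
  have norm_D: "norm (s *\<^sub>R p - circle_param \<theta>) = sqrt (D s \<theta>)" for s \<theta>
    unfolding norm_diff_circle_param D_def \<rho>_def c_def
    by (simp add: power_mult_distrib algebra_simps)
  have D_pos: "0 < D s \<theta>" if "s \<in> U" for s \<theta>
    using circle_param_distance_pos[of "s *\<^sub>R p" \<theta>] that
    by (simp add: D_def U_def \<rho>_def c_def power_mult_distrib algebra_simps)
  have "open U"
    unfolding U_def by (intro open_Collect_less continuous_intros)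
  have "convex U"
  proof -
    have "U = {s. norm (s *\<^sub>R p) < 1}" by (auto simp: U_def \<rho>_def)
    also have "\<dots> = (\<lambda>s. s *\<^sub>R p) -` ball 0 1" by auto
    also have "convex \<dots>"
      by (intro convex_linear_vimage convex_ball linearI) (auto simp: algebra_simps)
    finally show ?thesis .
  qed
  have [simp]: "1 \<in> U" using rho by (simp add: U_def)
  have D_cont: "continuous_on (U \<times> {0..2 * pi}) (\<lambda>(s, \<theta>). D s \<theta>)"
    unfolding D_def c_def split_beta by (intro continuous_intros)
  have "((\<lambda>s. integral (cbox 0 (2 * pi)) (\<lambda>\<theta>. d / sqrt (D s \<theta>))) has_field_derivative
        integral (cbox 0 (2 * pi)) (\<lambda>\<theta>. d * (c \<theta> - 1 * \<rho>\<^sup>2) / (D 1 \<theta> * sqrt (D 1 \<theta>)))) (at 1 within U)"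
  proof (rule leibniz_rule_field_derivative)
    fix s \<theta> assume "s \<in> U"
    note D = D_pos[OF this, of \<theta>]
    have "((\<lambda>s. D s \<theta>) has_real_derivative 2 * (s * \<rho>\<^sup>2 - c \<theta>)) (at s)"
      unfolding D_def by (auto intro!: derivative_eq_intros simp: power2_eq_square algebra_simps)
    then have "((\<lambda>s. d / sqrt (D s \<theta>)) has_real_derivative d * (c \<theta> - s * \<rho>\<^sup>2) / (D s \<theta> * sqrt (D s \<theta>))) (at s)"
      using D by (auto intro!: derivative_eq_intros simp: divide_simps algebra_simps)
    then show "((\<lambda>s. d / sqrt (D s \<theta>)) has_field_derivative
        d * (c \<theta> - s * \<rho>\<^sup>2) / (D s \<theta> * sqrt (D s \<theta>))) (at s within U)"
      by (rule has_field_derivative_at_within)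
  next
    fix s assume s: "s \<in> U"
    then show "(\<lambda>\<theta>. d / sqrt (D s \<theta>)) integrable_on cbox 0 (2 * pi)"
      using D_pos[OF s]
      by (intro integrable_continuous continuous_intros) (auto simp: D_def c_def intro!: continuous_intros simp: less_imp_neq[symmetric])
  next
    show "continuous_on (U \<times> cbox 0 (2 * pi)) (\<lambda>(s, \<theta>). d * (c \<theta> - s * \<rho>\<^sup>2) / (D s \<theta> * sqrt (D s \<theta>)))"
      using D_cont D_pos unfolding split_beta c_def
      by (intro continuous_intros) (fastforce simp: less_imp_neq[symmetric])+
  qed (use \<open>convex U\<close> in auto)
  then have "((\<lambda>s. ring_potential d (s *\<^sub>R p)) has_real_derivative - (integral {0..2 * pi} (\<lambda>\<theta>. d * f \<theta>))) (at 1)"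
    using at_within_open[OF _ \<open>open U\<close>, of 1]
    by (auto simp: ring_potential_altdef norm_D f_def intro!: derivative_intros)
  moreover have "((\<lambda>s. ring_potential d (s *\<^sub>R p)) has_real_derivative g \<bullet> p) (at 1)"
    using assms by (intro gderiv_along_curve) (auto intro!: derivative_eq_intros)
  ultimately have "g \<bullet> p = - (d * integral {0..2 * pi} f)"
    by (simp add: DERIV_unique)
  moreover have "0 \<le> integral {0..2 * pi} f"
  proof -
    \<comment> \<open>The function \<open>f\<close> is the radial integrand, and \<open>h\<close> is the nonnegative one that it is traded for.\<close>
    define h where "h = (\<lambda>\<theta>. (c \<theta> - \<rho>\<^sup>2)\<^sup>2 / (D 1 \<theta> * sqrt (D 1 \<theta>)))"
    have D1: "0 < D 1 \<theta>" for \<theta> by (simp add: D_pos)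
    have cont: "continuous_on A c" "continuous_on A (D 1)" for A
      unfolding c_def D_def by (intro continuous_intros)+
    have int: "f integrable_on {0..2 * pi}" "h integrable_on {0..2 * pi}"
      unfolding f_def h_def using D1
      by (auto intro!: integrable_continuous_real continuous_intros cont simp: less_imp_neq[symmetric])
    have "((\<lambda>\<theta>. h \<theta> - (1 - \<rho>\<^sup>2) * f \<theta>) has_integral
        q (2 * pi) / sqrt (D 1 (2 * pi)) - q 0 / sqrt (D 1 0)) {0..2 * pi}"
    proof (rule fundamental_theorem_of_calculus)
      fix \<theta>
      have q: "(q has_real_derivative - c \<theta>) (at \<theta>)"
        unfolding q_def c_def by (auto intro!: derivative_eq_intros)
      have D: "(D 1 has_real_derivative - 2 * q \<theta>) (at \<theta>)"
        unfolding D_def q_def c_def by (auto intro!: derivative_eq_intros simp: algebra_simps)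
      have "\<rho>\<^sup>2 = (p$1)\<^sup>2 + (p$2)\<^sup>2"
        using assms by (simp add: \<rho>_def norm_vector_3)
      also have "\<dots> = ((p$1)\<^sup>2 + (p$2)\<^sup>2) * ((sin \<theta>)\<^sup>2 + (cos \<theta>)\<^sup>2)"
        by simp
      also have "\<dots> = (c \<theta>)\<^sup>2 + (q \<theta>)\<^sup>2"
        unfolding c_def q_def by algebra
      finally have pyth: "(q \<theta>)\<^sup>2 = \<rho>\<^sup>2 - (c \<theta>)\<^sup>2" by simp
      have "((\<lambda>\<theta>. q \<theta> / sqrt (D 1 \<theta>)) has_real_derivative
          ((q \<theta>)\<^sup>2 - c \<theta> * D 1 \<theta>) / (D 1 \<theta> * sqrt (D 1 \<theta>))) (at \<theta>)"
        using D1[of \<theta>]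
        by (auto intro!: derivative_eq_intros q D simp: divide_simps power2_eq_square algebra_simps)
      also have "(q \<theta>)\<^sup>2 - c \<theta> * D 1 \<theta> = (c \<theta> - \<rho>\<^sup>2)\<^sup>2 - (1 - \<rho>\<^sup>2) * (c \<theta> - \<rho>\<^sup>2)"
        unfolding pyth D_def by algebra
      also have "\<dots> / (D 1 \<theta> * sqrt (D 1 \<theta>)) = h \<theta> - (1 - \<rho>\<^sup>2) * f \<theta>"
        unfolding h_def f_def by (subst diff_divide_distrib) simp
      finally show "((\<lambda>\<theta>. q \<theta> / sqrt (D 1 \<theta>)) has_vector_derivative h \<theta> - (1 - \<rho>\<^sup>2) * f \<theta>)
          (at \<theta> within {0..2 * pi})"
        by (simp add: has_real_derivative_iff_has_vector_derivative has_vector_derivative_at_within)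
    qed simp
    moreover have "q (2 * pi) / sqrt (D 1 (2 * pi)) - q 0 / sqrt (D 1 0) = 0"
      by (simp add: q_def D_def c_def)
    ultimately have "integral {0..2 * pi} (\<lambda>\<theta>. h \<theta> - (1 - \<rho>\<^sup>2) * f \<theta>) = 0"
      by (simp add: integral_unique)
    then have "(1 - \<rho>\<^sup>2) * integral {0..2 * pi} f = integral {0..2 * pi} h"
      using Henstock_Kurzweil_Integration.integral_diff[OF int(2) integrable_on_mult_right[OF int(1), of "1 - \<rho>\<^sup>2"]]
      by simp
    moreover have "0 \<le> integral {0..2 * pi} h"
      using D1 by (intro Henstock_Kurzweil_Integration.integral_nonneg int)
        (simp add: h_def less_imp_le)
    moreover have "\<rho>\<^sup>2 < 1" using rho by (simp add: power_less_one_iff abs_square_less_1)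
    ultimately show ?thesis
      by (metis diff_gt_0_iff_gt zero_le_mult_iff not_le)
  qed
  ultimately show ?thesis using assms by simp
qed

section \<open>Monotonicity and comparison of real functions\<close>

text \<open>
  The mean value theorem for either order of \<open>a\<close> and \<open>t\<close>. The product in the conclusion says that
  \<open>z\<close> lies on the same side of \<open>a\<close> as \<open>t\<close>; sign conditions below have the form
  \<open>0 \<le> (t - a) * f' t\<close> so that the times before and after \<open>a\<close> need no separate treatment.
\<close>

lemma mean_value_on_interval:
  fixes f :: "real \<Rightarrow> real"
  assumes "is_interval I" "a \<in> I" "t \<in> I" "t \<noteq> a"
    and der: "\<And>s. s \<in> I \<Longrightarrow> (f has_real_derivative f' s) (at s)"
  obtains z where "z \<in> I" "0 < (z - a) * (t - a)" "f t - f a = (t - a) * f' z"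
proof (cases "a < t")
  case True
  have "s \<in> I" if "a \<le> s" "s \<le> t" for s
    using that assms by (meson mem_is_interval_1_I)
  then show ?thesis
    using MVT2[OF True, of f f'] der that by (metis diff_gt_0_iff_gt less_imp_le mult_pos_pos True)
next
  case False
  with assms have "t < a" by simp
  have "s \<in> I" if "t \<le> s" "s \<le> a" for s
    using that assms by (meson mem_is_interval_1_I)
  then obtain z where "z \<in> I" "t < z" "z < a" "f a - f t = (a - t) * f' z"
    using MVT2[OF \<open>t < a\<close>, of f f'] der by (metis less_imp_le)
  with \<open>t < a\<close> show ?thesis
    by (intro that[of z] mult_neg_neg) (auto simp: algebra_simps)
qed

lemma minimum_by_derivative_sign:
  fixes f :: "real \<Rightarrow> real"
  assumes "is_interval I" "a \<in> I" "t \<in> I"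
    and "\<And>s. s \<in> I \<Longrightarrow> (f has_real_derivative f' s) (at s)"
    and sign: "\<And>s. s \<in> I \<Longrightarrow> 0 \<le> (s - a) * f' s"
  shows "f a \<le> f t"
proof (cases "t = a")
  case False
  then obtain z where z: "z \<in> I" "0 < (z - a) * (t - a)" "f t - f a = (t - a) * f' z"
    using mean_value_on_interval assms by metis
  then have "0 \<le> (t - a) * f' z"
    using sign[of z] by (auto simp: zero_less_mult_iff zero_le_mult_iff)
  with z show ?thesis by simp
qed simp

lemma zero_derivative_imp_constant:
  fixes f :: "real \<Rightarrow> real"
  assumes "is_interval I" "a \<in> I" "t \<in> I"
    and "\<And>s. s \<in> I \<Longrightarrow> (f has_real_derivative 0) (at s)"
  shows "f t = f a"
proof (cases "t = a")
  case False
  from mean_value_on_interval[OF assms(1-3) this assms(4)] show ?thesis by force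
qed simp

text \<open>
  If \<open>w'' = \<phi> w\<close> with \<open>\<phi> \<ge> 0\<close>, then \<open>w w'\<close> is nondecreasing, its derivative being
  \<open>w'\<^sup>2 + \<phi> w\<^sup>2\<close>. When it vanishes at \<open>a\<close>, it is nonpositive before \<open>a\<close> and nonnegative after,
  and so are the derivatives \<open>2 w w'\<close> of \<open>w\<^sup>2\<close> and \<open>2 \<phi> w w'\<close> of \<open>w'\<^sup>2\<close>. This keeps \<open>y\<close> and the horizontal velocity of an orbit
  away from zero.
\<close>

lemma squares_minimal_under_repulsion:
  fixes w v \<phi> :: "real \<Rightarrow> real"
  assumes I: "is_interval I" "a \<in> I" "t \<in> I"
    and dw: "\<And>s. s \<in> I \<Longrightarrow> (w has_real_derivative v s) (at s)"
    and dv: "\<And>s. s \<in> I \<Longrightarrow> (v has_real_derivative \<phi> s * w s) (at s)"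
    and nonneg: "\<And>s. s \<in> I \<Longrightarrow> 0 \<le> \<phi> s"
    and start: "w a * v a = 0"
  shows "(w a)\<^sup>2 \<le> (w t)\<^sup>2" and "(v a)\<^sup>2 \<le> (v t)\<^sup>2"
proof -
  have sign: "0 \<le> (s - a) * (w s * v s)" if "s \<in> I" for s
  proof (cases "s = a")
    case False
    have "((\<lambda>s. w s * v s) has_real_derivative (v s)\<^sup>2 + \<phi> s * (w s)\<^sup>2) (at s)" if "s \<in> I" for s
      using dw[OF that] dv[OF that]
      by (auto intro!: derivative_eq_intros simp: power2_eq_square algebra_simps)
    from mean_value_on_interval[OF I(1,2) \<open>s \<in> I\<close> False this]
    obtain z where z: "z \<in> I" "w s * v s - w a * v a = (s - a) * ((v z)\<^sup>2 + \<phi> z * (w z)\<^sup>2)"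
      by metis
    then have "(s - a) * (w s * v s) = (s - a)\<^sup>2 * ((v z)\<^sup>2 + \<phi> z * (w z)\<^sup>2)"
      using start by (simp add: power2_eq_square)
    then show ?thesis using nonneg[OF z(1)] by simp
  qed simp
  have "((\<lambda>s. (w s)\<^sup>2) has_real_derivative 2 * (w s * v s)) (at s)" if "s \<in> I" for s
    using dw[OF that] by (auto intro!: derivative_eq_intros)
  then show "(w a)\<^sup>2 \<le> (w t)\<^sup>2"
    by (rule minimum_by_derivative_sign[OF I]) (use sign in \<open>auto simp: algebra_simps\<close>)
  have "((\<lambda>s. (v s)\<^sup>2) has_real_derivative 2 * \<phi> s * (w s * v s)) (at s)" if "s \<in> I" for s
    using dv[OF that] by (auto intro!: derivative_eq_intros)
  then show "(v a)\<^sup>2 \<le> (v t)\<^sup>2"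
  proof (rule minimum_by_derivative_sign[OF I])
    fix s assume "s \<in> I"
    then have "0 \<le> 2 * \<phi> s * ((s - a) * (w s * v s))"
      using sign nonneg by simp
    then show "0 \<le> (s - a) * (2 * \<phi> s * (w s * v s))" by (simp add: algebra_simps)
  qed
qed

lemma nonvanishing_same_sign:
  fixes f :: "real \<Rightarrow> real"
  assumes "is_interval I" "a \<in> I" "t \<in> I" "continuous_on I f" "\<And>s. s \<in> I \<Longrightarrow> f s \<noteq> 0"
  shows "0 < f a * f t"
proof (rule ccontr)
  assume "\<not> 0 < f a * f t"
  then have "f a \<le> 0 \<and> 0 \<le> f t \<or> f t \<le> 0 \<and> 0 \<le> f a"
    by (simp add: not_less mult_le_0_iff) linarith
  moreover have "is_interval (f ` I)"
    using assms by (simp add: connected_continuous_image is_interval_connected_1)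
  ultimately have "0 \<in> f ` I"
    using assms(2,3) by (meson imageI mem_is_interval_1_I)
  then show False using assms(5) by auto
qed

lemma has_real_derivative_shift:
  "(f has_real_derivative D) (at (a + s)) \<Longrightarrow> ((\<lambda>s. f (a + s)) has_real_derivative D) (at s)"
  "(f has_real_derivative D) (at (a - s)) \<Longrightarrow> ((\<lambda>s. f (a - s)) has_real_derivative - D) (at s)"
proof -
  have "((\<lambda>s. a + s) has_real_derivative 1) (at s)" "((\<lambda>s. a - s) has_real_derivative - 1) (at s)"
    by (auto intro!: derivative_eq_intros)
  then show "(f has_real_derivative D) (at (a + s)) \<Longrightarrow> ((\<lambda>s. f (a + s)) has_real_derivative D) (at s)"
    "(f has_real_derivative D) (at (a - s)) \<Longrightarrow> ((\<lambda>s. f (a - s)) has_real_derivative - D) (at s)"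
    using DERIV_chain2[of f D "\<lambda>s. a + s" s 1] DERIV_chain2[of f D "\<lambda>s. a - s" s "-1"] by auto
qed

text \<open>
  Two increasing motions with the same start and the same speed at equal values coincide, because
  both take the time \<open>\<integral> dv / speed(v)\<close> to reach a value. The integral is avoided by means of the
  function \<open>h\<close> for which \<open>g (h s) = f s\<close>: it has derivative 1, hence \<open>h b = b\<close>. The speed may
  vanish at the start, where \<open>f' = speed(f)\<close> admits solutions that wait for a while; positive speed
  at all later times excludes them. The inequality \<open>f b \<le> g b\<close> makes \<open>h\<close> well defined on
  all of \<open>[0, b]\<close>, and the opposite case follows by exchanging \<open>f\<close> and \<open>g\<close>.
\<close>

lemma eq_if_equal_speed_at_equal_value_and_le:
  fixes f g f' g' :: "real \<Rightarrow> real"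
  assumes "0 < b" and cont: "continuous_on {0..b} f" "continuous_on {0..b} g" and "f 0 = g 0"
    and df: "\<And>s. 0 < s \<Longrightarrow> s \<le> b \<Longrightarrow> (f has_real_derivative f' s) (at s)"
    and dg: "\<And>s. 0 < s \<Longrightarrow> s \<le> b \<Longrightarrow> (g has_real_derivative g' s) (at s)"
    and pos: "\<And>s. 0 < s \<Longrightarrow> s \<le> b \<Longrightarrow> 0 < f' s" "\<And>s. 0 < s \<Longrightarrow> s \<le> b \<Longrightarrow> 0 < g' s"
    and speed: "\<And>s s'. 0 < s \<Longrightarrow> s \<le> b \<Longrightarrow> 0 < s' \<Longrightarrow> s' \<le> b \<Longrightarrow> f s = g s' \<Longrightarrow> f' s = g' s'"
    and "f b \<le> g b"
  shows "f b = g b"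
proof -
  have mono_f: "f s < f t" if "0 \<le> s" "s < t" "t \<le> b" for s t
  proof (rule DERIV_pos_imp_increasing_open[OF that(2)])
    show "continuous_on {s..t} f"
      using that by (intro continuous_on_subset[OF cont(1)]) auto
    show "\<exists>y. (f has_real_derivative y) (at z) \<and> 0 < y" if "s < z" "z < t" for z
      using df[of z] pos(1)[of z] that \<open>0 \<le> s\<close> \<open>t \<le> b\<close> by auto
  qed
  have mono_g: "g s < g t" if "0 \<le> s" "s < t" "t \<le> b" for s t
  proof (rule DERIV_pos_imp_increasing_open[OF that(2)])
    show "continuous_on {s..t} g"
      using that by (intro continuous_on_subset[OF cont(2)]) auto
    show "\<exists>y. (g has_real_derivative y) (at z) \<and> 0 < y" if "s < z" "z < t" for z
      using dg[of z] pos(2)[of z] that \<open>0 \<le> s\<close> \<open>t \<le> b\<close> by auto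
  qed
  have inj: "inj_on g {0..b}"
    using mono_g by (intro linorder_inj_onI) (auto simp: less_imp_neq)
  define T where "T = the_inv_into {0..b} g"
  have Tg: "T (g s) = s" if "0 \<le> s" "s \<le> b" for s
    unfolding T_def using that by (intro the_inv_into_f_f[OF inj]) auto
  have image: "{g 0..g b} \<subseteq> g ` {0..b}"
    using IVT'[of g 0 _ b] cont \<open>0 < b\<close> by force
  have gT: "g (T v) = v" "T v \<in> {0..b}" if "g 0 \<le> v" "v \<le> g b" for v
    using image that Tg by force+
  have cont_T: "continuous_on {g 0..g b} T"
    unfolding T_def
    by (rule continuous_on_subset[OF continuous_on_inv_into[OF cont(2) compact_Icc inj] image])
  have f_range: "f s \<in> {g 0..g b}" if "s \<in> {0..b}" for s
    using that mono_f[of 0 s] mono_f[of s b] \<open>f 0 = g 0\<close> \<open>f b \<le> g b\<close>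
    by (cases "s = 0"; cases "s = b") auto
  define h where "h = T \<circ> f"
  have "continuous_on {0..b} h"
    unfolding h_def using f_range cont_T cont(1)
    by (intro continuous_on_compose continuous_on_subset[OF cont_T]) auto
  moreover have "(h has_real_derivative 1) (at s)" if "0 < s" "s < b" for s
  proof -
    have v: "g 0 < f s" "f s < g b"
      using that mono_f[of 0 s] mono_f[of s b] \<open>f 0 = g 0\<close> \<open>f b \<le> g b\<close> by auto
    then have Tv: "0 < T (f s)" "T (f s) \<le> b"
      using gT[of "f s"] by (auto simp: less_le)
    have "(T has_real_derivative inverse (g' (T (f s)))) (at (f s))"
    proof (rule DERIV_inverse_function[where f = g and g = T and x = "f s", OF dg[OF Tv] _ v])
      show "g' (T (f s)) \<noteq> 0" using pos(2)[OF Tv] by simp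
      show "g (T v) = v" if "g 0 < v" "v < g b" for v using gT that by simp
      show "isCont T (f s)"
        using cont_T v by (intro continuous_on_interior[OF cont_T]) (auto simp: interior_atLeastAtMost_real)
    qed
    moreover have "g' (T (f s)) = f' s"
      using speed[of s "T (f s)"] that Tv gT v by simp
    ultimately show ?thesis
      unfolding h_def using DERIV_chain[of T "inverse (f' s)" f s "f' s"] df[of s] pos(1)[of s] that
      by simp
  qed
  ultimately have "h b - h 0 = b"
    using MVT[OF \<open>0 < b\<close>, of h] by (metis DERIV_unique diff_zero mult.right_neutral real_differentiable_def)
  moreover have "h 0 = 0" using Tg[of 0] \<open>f 0 = g 0\<close> \<open>0 < b\<close> by (simp add: h_def)
  ultimately show ?thesis using gT[of "f b"] f_range[of b] \<open>0 < b\<close> by (simp add: h_def)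
qed

lemma eq_if_equal_speed_at_equal_value:
  fixes f g f' g' :: "real \<Rightarrow> real"
  assumes "0 < b" "continuous_on {0..b} f" "continuous_on {0..b} g" "f 0 = g 0"
    and "\<And>s. 0 < s \<Longrightarrow> s \<le> b \<Longrightarrow> (f has_real_derivative f' s) (at s)"
    and "\<And>s. 0 < s \<Longrightarrow> s \<le> b \<Longrightarrow> (g has_real_derivative g' s) (at s)"
    and "\<And>s. 0 < s \<Longrightarrow> s \<le> b \<Longrightarrow> 0 < f' s" "\<And>s. 0 < s \<Longrightarrow> s \<le> b \<Longrightarrow> 0 < g' s"
    and "\<And>s s'. 0 < s \<Longrightarrow> s \<le> b \<Longrightarrow> 0 < s' \<Longrightarrow> s' \<le> b \<Longrightarrow> f s = g s' \<Longrightarrow> f' s = g' s'"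
  shows "f b = g b"
proof (cases "f b \<le> g b")
  case True
  show ?thesis by (rule eq_if_equal_speed_at_equal_value_and_le[OF assms True])
next
  case False
  have "g b = f b"
  proof (rule eq_if_equal_speed_at_equal_value_and_le[where f = g and g = f and f' = g' and g' = f'])
    show "g' s = f' s'" if "0 < s" "s \<le> b" "0 < s'" "s' \<le> b" "g s = f s'" for s s'
      using assms(9)[of s' s] that by simp
  qed (use assms False in auto)
  then show ?thesis by simp
qed

section \<open>Motion under a repulsive central force\<close>

locale central_motion =
  fixes I :: "real set" and x y vx vy \<phi> :: "real \<Rightarrow> real"
  assumes interval: "is_interval I"
    and dx: "\<And>t. t \<in> I \<Longrightarrow> (x has_real_derivative vx t) (at t)"
    and dy: "\<And>t. t \<in> I \<Longrightarrow> (y has_real_derivative vy t) (at t)"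
    and dvx: "\<And>t. t \<in> I \<Longrightarrow> (vx has_real_derivative \<phi> t * x t) (at t)"
    and dvy: "\<And>t. t \<in> I \<Longrightarrow> (vy has_real_derivative \<phi> t * y t) (at t)"

lemma (in central_motion) angular_momentum_const:
  assumes "s \<in> I" "t \<in> I"
  shows "x t * vy t - vx t * y t = x s * vy s - vx s * y s"
proof -
  have "((\<lambda>t. x t * vy t - vx t * y t) has_real_derivative 0) (at t)" if "t \<in> I" for t
    using dx[OF that] dy[OF that] dvx[OF that] dvy[OF that]
    by (auto intro!: derivative_eq_intros simp: algebra_simps)
  from zero_derivative_imp_constant[OF interval assms this] show ?thesis by simp
qed

text \<open>
  The initial data are those of a normalized orbit at its closest point: it sits on the positive
  \<open>y\<close>-axis and moves horizontally.
\<close>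

locale repulsive_motion = central_motion +
  fixes t0 :: real
  assumes repulsive: "\<And>t. t \<in> I \<Longrightarrow> 0 \<le> \<phi> t"
    and t0: "t0 \<in> I"
    and apsis: "x t0 = 0" "0 < y t0" "vy t0 = 0" "vx t0 \<noteq> 0"
begin

lemma angular_momentum_eq: "x t * vy t - vx t * y t = - vx t0 * y t0" if "t \<in> I"
  using angular_momentum_const[OF t0 that] apsis by simp

lemma y_pos: "0 < y t" if "t \<in> I" for t
proof -
  have "(y t0)\<^sup>2 \<le> (y s)\<^sup>2" if "s \<in> I" for s
    by (rule squares_minimal_under_repulsion[OF interval t0 that dy dvy repulsive]) (use apsis in auto)
  then have "y s \<noteq> 0" if "s \<in> I" for s
    using that apsis(2) by fastforce
  moreover have "continuous_on I y"
    using dy by (meson DERIV_atLeastAtMost_imp_continuous_on DERIV_isCont continuous_at_imp_continuous_on)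
  ultimately have "0 < y t0 * y t"
    using nonvanishing_same_sign[OF interval t0 that] by blast
  with apsis show ?thesis by (simp add: zero_less_mult_iff)
qed

lemma vx_same_sign: "0 < vx t0 * vx t" if "t \<in> I" for t
proof -
  have "(vx t0)\<^sup>2 \<le> (vx s)\<^sup>2" if "s \<in> I" for s
    by (rule squares_minimal_under_repulsion[OF interval t0 that dx dvx repulsive]) (use apsis in auto)
  then have "vx s \<noteq> 0" if "s \<in> I" for s
    using that apsis(4) by fastforce
  moreover have "continuous_on I vx"
    using dvx by (meson DERIV_isCont continuous_at_imp_continuous_on)
  ultimately show ?thesis
    using nonvanishing_same_sign[OF interval t0 that] by blast
qed

lemma inj_on_x: "inj_on x I"
proof (rule inj_onI, rule ccontr)
  fix s t assume st: "s \<in> I" "t \<in> I" "x s = x t" "s \<noteq> t"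
  with mean_value_on_interval[OF interval st(1,2) _ dx]
  obtain z where "z \<in> I" "0 = (t - s) * vx z" by force
  with st vx_same_sign[of z] show False by auto
qed

text \<open>
  The slope \<open>m = vy / vx\<close> has the derivative \<open>\<phi> (y vx - x vy) / vx\<^sup>2\<close>, whose numerator is \<open>\<phi>\<close> times
  the constant \<open>y(t0) vx(t0)\<close>. So \<open>m\<close> does not decrease as \<open>x\<close> increases, whichever sign \<open>vx\<close>
  has, and the orbit lies above each of its tangents.
\<close>

lemma above_tangent:
  assumes s: "s \<in> I" and t: "t \<in> I"
  shows "y s + vy s / vx s * (x t - x s) \<le> y t"
proof -
  define m where "m = (\<lambda>t. vy t / vx t)"
  have vx: "vx t \<noteq> 0" if "t \<in> I" for t using vx_same_sign[OF that] by auto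
  have dm: "(m has_real_derivative \<phi> t * (y t0 * vx t0) / (vx t)\<^sup>2) (at t)" if "t \<in> I" for t
  proof -
    have "(m has_real_derivative (\<phi> t * y t * vx t - vy t * (\<phi> t * x t)) / (vx t * vx t)) (at t)"
      unfolding m_def using dvx[OF that] dvy[OF that] vx[OF that]
      by (auto intro!: derivative_eq_intros)
    also have "\<phi> t * y t * vx t - vy t * (\<phi> t * x t) = \<phi> t * (y t0 * vx t0)"
      using angular_momentum_eq[OF that] by algebra
    finally show ?thesis by (simp add: power2_eq_square)
  qed
  have m_mono: "0 \<le> (t - s) * vx t * (m t - m s)" if "t \<in> I" for t
  proof (cases "t = s")
    case False
    from mean_value_on_interval[OF interval s that False dm]
    obtain z where z: "z \<in> I" "m t - m s = (t - s) * (\<phi> z * (y t0 * vx t0) / (vx z)\<^sup>2)"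
      by metis
    have "(t - s) * vx t * (m t - m s) = (t - s)\<^sup>2 * \<phi> z * y t0 * (vx t0 * vx t) / (vx z)\<^sup>2"
      unfolding z(2) by (simp add: power2_eq_square)
    also have "0 \<le> \<dots>"
      using repulsive[OF z(1)] apsis vx_same_sign[OF that] by simp
    finally show ?thesis .
  qed simp
  define F where "F = (\<lambda>t. y t - m s * x t)"
  have "F s \<le> F t"
  proof (rule minimum_by_derivative_sign[OF interval s t])
    fix t assume t: "t \<in> I"
    show "(F has_real_derivative vx t * (m t - m s)) (at t)"
      unfolding F_def using dx[OF t] dy[OF t] vx[OF t] vx[OF s]
      by (auto intro!: derivative_eq_intros simp: m_def field_simps)
    show "0 \<le> (t - s) * (vx t * (m t - m s))" using m_mono[OF t] by (simp add: mult.assoc)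
  qed
  then show ?thesis by (simp add: F_def m_def right_diff_distrib)
qed

text \<open>
  \<open>q\<close> is half the time derivative of the squared distance \<open>u\<close> from the origin.
\<close>

definition u :: "real \<Rightarrow> real" where "u t = (x t)\<^sup>2 + (y t)\<^sup>2"
definition q :: "real \<Rightarrow> real" where "q t = x t * vx t + y t * vy t"

lemma du: "(u has_real_derivative 2 * q t) (at t)" if "t \<in> I"
  unfolding u_def[abs_def] q_def using dx[OF that] dy[OF that]
  by (auto intro!: derivative_eq_intros simp: algebra_simps)

text \<open>
  \<open>u\<close> is strictly convex in time, since \<open>q' = vx\<^sup>2 + vy\<^sup>2 + \<phi> u\<close> is positive,
  and it is stationary at \<open>t0\<close>.
\<close>

lemma recedes: "0 < (t - t0) * q t" if t: "t \<in> I" "t \<noteq> t0" for t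
proof -
  have "(q has_real_derivative (vx s)\<^sup>2 + (vy s)\<^sup>2 + \<phi> s * u s) (at s)" if "s \<in> I" for s
    unfolding u_def q_def[abs_def] using dx[OF that] dy[OF that] dvx[OF that] dvy[OF that]
    by (auto intro!: derivative_eq_intros simp: power2_eq_square algebra_simps)
  from mean_value_on_interval[OF interval t0 t this]
  obtain z where z: "z \<in> I" "q t - q t0 = (t - t0) * ((vx z)\<^sup>2 + (vy z)\<^sup>2 + \<phi> z * u z)"
    by metis
  have "0 < (vx z)\<^sup>2 + (vy z)\<^sup>2 + \<phi> z * u z"
    using vx_same_sign[OF z(1)] repulsive[OF z(1)]
    by (intro add_pos_nonneg) (auto simp: u_def)
  moreover have "(t - t0) * q t = (t - t0)\<^sup>2 * ((vx z)\<^sup>2 + (vy z)\<^sup>2 + \<phi> z * u z)"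
    using z(2) apsis by (simp add: q_def power2_eq_square)
  ultimately show ?thesis using t by simp
qed

lemma reflected_time_interval: "is_interval {h. t0 + h \<in> I \<and> t0 - h \<in> I}"
  unfolding is_interval_1
proof (intro ballI allI impI CollectI)
  fix a b c assume "a \<in> {h. t0 + h \<in> I \<and> t0 - h \<in> I}" "b \<in> {h. t0 + h \<in> I \<and> t0 - h \<in> I}" "a \<le> c \<and> c \<le> b"
  then show "t0 + c \<in> I \<and> t0 - c \<in> I"
    using interval mem_is_interval_1_I[of I "t0 + a" "t0 + b" "t0 + c"]
      mem_is_interval_1_I[of I "t0 - b" "t0 - a" "t0 - c"] by auto
qed

text \<open>
  The assumption \<open>radial\<close> is what conservation of energy and angular momentum provide: the
  radial speed is determined by the distance. Hence \<open>u (t0 + h)\<close> and \<open>u (t0 - h)\<close>, as functions of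
  \<open>h > 0\<close>, increase with the same speed at equal values.
\<close>

lemma u_even:
  assumes radial: "\<forall>s\<in>I. \<forall>t\<in>I. u s = u t \<longrightarrow> (q s)\<^sup>2 = (q t)\<^sup>2"
    and h: "t0 + h \<in> I" "t0 - h \<in> I"
  shows "u (t0 + h) = u (t0 - h)"
proof -
  have *: "u (t0 + b) = u (t0 - b)" if b: "0 < b" "t0 + b \<in> I" "t0 - b \<in> I" for b
  proof -
    have in_I: "t0 + s \<in> I" "t0 - s \<in> I" if "0 \<le> s" "s \<le> b" for s
      using that b interval t0 mem_is_interval_1_I[of I t0 "t0 + b" "t0 + s"]
        mem_is_interval_1_I[of I "t0 - b" t0 "t0 - s"] by auto
    have df: "((\<lambda>s. u (t0 + s)) has_real_derivative 2 * q (t0 + s)) (at s)" if "0 \<le> s" "s \<le> b" for s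
      using has_real_derivative_shift(1)[OF du[OF in_I(1)[OF that]]] .
    have dg: "((\<lambda>s. u (t0 - s)) has_real_derivative - 2 * q (t0 - s)) (at s)" if "0 \<le> s" "s \<le> b" for s
      using has_real_derivative_shift(2)[OF du[OF in_I(2)[OF that]]] by simp
    show ?thesis
    proof (rule eq_if_equal_speed_at_equal_value[where b = b and f = "\<lambda>s. u (t0 + s)" and g = "\<lambda>s. u (t0 - s)"
          and f' = "\<lambda>s. 2 * q (t0 + s)" and g' = "\<lambda>s. - 2 * q (t0 - s)"])
      show "continuous_on {0..b} (\<lambda>s. u (t0 + s))" "continuous_on {0..b} (\<lambda>s. u (t0 - s))"
        using df dg by (meson DERIV_isCont atLeastAtMost_iff continuous_at_imp_continuous_on)+
      show pos: "0 < 2 * q (t0 + s)" "0 < - 2 * q (t0 - s)" if "0 < s" "s \<le> b" for s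
        using recedes[of "t0 + s"] recedes[of "t0 - s"] in_I[of s] that
        by (auto simp: zero_less_mult_iff mult_less_0_iff)
      show "2 * q (t0 + s) = - 2 * q (t0 - s')"
        if "0 < s" "s \<le> b" "0 < s'" "s' \<le> b" "u (t0 + s) = u (t0 - s')" for s s'
        using radial[rule_format, of "t0 + s" "t0 - s'"] that in_I[of s] in_I[of s'] pos[of s] pos[of s']
        by (auto simp: power2_eq_iff)
    qed (use b df dg in auto)
  qed
  show ?thesis using *[of h] *[of "-h"] h by (cases h "0::real" rule: linorder_cases) auto
qed

text \<open>
  The polar angle \<open>\<theta>\<close>, measured from the \<open>y\<close>-axis, changes at the rate \<open>L / u\<close> by the law of
  areas. As \<open>u\<close> is even about \<open>t0\<close>, the angle is odd; distance and angle together determine the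
  position.
\<close>

lemma motion_even:
  assumes radial: "\<forall>s\<in>I. \<forall>t\<in>I. u s = u t \<longrightarrow> (q s)\<^sup>2 = (q t)\<^sup>2"
    and h: "t0 + h \<in> I" "t0 - h \<in> I"
  shows "x (t0 - h) = - x (t0 + h)" and "y (t0 - h) = y (t0 + h)"
proof -
  define L where "L = vx t0 * y t0"
  define \<theta> where "\<theta> = (\<lambda>t. arctan (x t / y t))"
  have d\<theta>: "(\<theta> has_real_derivative L / u t) (at t)" if "t \<in> I" for t
  proof -
    have y: "y t \<noteq> 0" "u t \<noteq> 0" using y_pos[OF that] by (auto simp: u_def sum_power2_eq_zero_iff)
    have "((\<lambda>t. x t / y t) has_real_derivative L / (y t)\<^sup>2) (at t)"
      using dx[OF that] dy[OF that] y angular_momentum_eq[OF that]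
      by (auto intro!: derivative_eq_intros simp: L_def power2_eq_square algebra_simps)
    then have "(\<theta> has_real_derivative inverse (1 + (x t / y t)\<^sup>2) * (L / (y t)\<^sup>2)) (at t)"
      unfolding \<theta>_def by (intro DERIV_chain2[OF DERIV_arctan])
    also have "inverse (1 + (x t / y t)\<^sup>2) * (L / (y t)\<^sup>2) = L / u t"
    proof -
      have "(1 + (x t / y t)\<^sup>2) * (y t)\<^sup>2 = u t"
        using y by (simp add: u_def field_simps)
      then show ?thesis by (simp add: divide_simps mult.commute)
    qed
    finally show ?thesis .
  qed
  define J where "J = {h. t0 + h \<in> I \<and> t0 - h \<in> I}"
  define A where "A = (\<lambda>h. \<theta> (t0 + h) + \<theta> (t0 - h))"
  have "A h = A 0"
  proof (rule zero_derivative_imp_constant[where f = A and I = J])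
    show "is_interval J" "0 \<in> J" "h \<in> J"
      using reflected_time_interval t0 h by (auto simp: J_def)
    fix s assume s: "s \<in> J"
    then have "(A has_real_derivative L / u (t0 + s) - L / u (t0 - s)) (at s)"
      using DERIV_add[OF has_real_derivative_shift(1)[OF d\<theta>] has_real_derivative_shift(2)[OF d\<theta>], of t0 s t0]
      by (simp add: A_def J_def)
    then show "(A has_real_derivative 0) (at s)"
      using u_even[OF radial, of s] s by (simp add: J_def)
  qed
  then have "\<theta> (t0 - h) = - \<theta> (t0 + h)"
    using apsis by (simp add: A_def \<theta>_def)
  then have ratio: "x (t0 - h) / y (t0 - h) = - (x (t0 + h) / y (t0 + h))"
    unfolding \<theta>_def arctan_minus[symmetric] arctan_eq_iff .
  \<comment> \<open>Distance and angle give back \<open>y\<close>, which is positive.\<close>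
  have u_ratio: "u t = (y t)\<^sup>2 * (1 + (x t / y t)\<^sup>2)" if "t \<in> I" for t
    using y_pos[OF that] by (simp add: u_def field_simps)
  have "(y (t0 - h))\<^sup>2 * (1 + (x (t0 + h) / y (t0 + h))\<^sup>2) = (y (t0 + h))\<^sup>2 * (1 + (x (t0 + h) / y (t0 + h))\<^sup>2)"
    using u_even[OF radial h] u_ratio[OF h(1)] u_ratio[OF h(2)] unfolding ratio by auto
  moreover have "1 + (x (t0 + h) / y (t0 + h))\<^sup>2 \<noteq> 0"
    by (smt (verit) zero_le_power2)
  ultimately have "(y (t0 - h))\<^sup>2 = (y (t0 + h))\<^sup>2" by simp
  then show y: "y (t0 - h) = y (t0 + h)"
    using y_pos[OF h(1)] y_pos[OF h(2)] by (simp add: power2_eq_iff_nonneg)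
  show "x (t0 - h) = - x (t0 + h)"
    using ratio y_pos[OF h(1)] unfolding y by (simp add: field_simps)
qed

text \<open>
  \<open>x\<close> is injective, so the orbit is the graph of a function of \<open>x\<close>. This function is a supremum
  of its tangents, hence convex, and the symmetry of the orbit in time makes it even.
\<close>

lemma trace_is_even_convex_graph:
  assumes radial: "\<forall>s\<in>I. \<forall>t\<in>I. u s = u t \<longrightarrow> (q s)\<^sup>2 = (q t)\<^sup>2"
    and symmetric: "\<And>t. t \<in> I \<Longrightarrow> 2 * t0 - t \<in> I"
  obtains S Y where "is_interval S" "even_on S Y" "convex_on S Y" "S = x ` I"
    "\<And>t. t \<in> I \<Longrightarrow> y t = Y (x t)"
proof -
  define S where "S = x ` I"
  define Y where "Y = y \<circ> the_inv_into I x"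
  have Y: "Y (x t) = y t" if "t \<in> I" for t
    unfolding Y_def using the_inv_into_f_f[OF inj_on_x that] by simp
  have "continuous_on I x"
    using dx by (meson DERIV_isCont continuous_at_imp_continuous_on)
  then have S: "is_interval S"
    unfolding S_def using interval by (simp add: connected_continuous_image is_interval_connected_1)
  have "even_on S Y"
    unfolding even_on_def S_def
  proof (safe)
    fix t assume t: "t \<in> I"
    have mirrored: "x (2 * t0 - t) = - x t" "y (2 * t0 - t) = y t"
      using motion_even[OF radial, of "t - t0"] t symmetric[OF t] by (simp_all add: algebra_simps)
    then show "- x t \<in> x ` I" by (metis symmetric[OF t] imageI)
    show "Y (- x t) = Y (x t)"
      using Y[OF t] Y[OF symmetric[OF t]] mirrored by simp
  qed
  moreover have "convex_on S Y"
    unfolding convex_on_def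
  proof (intro conjI ballI allI impI)
    show conv: "convex S" using S by (simp add: is_interval_convex)
    fix a b \<alpha> \<beta> :: real
    assume ab: "a \<in> S" "b \<in> S" and w: "0 \<le> \<alpha>" "0 \<le> \<beta>" "\<alpha> + \<beta> = 1"
    from ab obtain s t where st: "s \<in> I" "a = x s" "t \<in> I" "b = x t" by (auto simp: S_def)
    have "\<alpha> *\<^sub>R a + \<beta> *\<^sub>R b \<in> S" by (rule convexD[OF conv ab w])
    then obtain z where z: "z \<in> I" "\<alpha> * a + \<beta> * b = x z" by (auto simp: S_def)
    define m where "m = vy z / vx z"
    have "y z = \<alpha> * (y z + m * (a - x z)) + \<beta> * (y z + m * (b - x z))"
      using w unfolding z(2)[symmetric] by algebra
    also have "\<dots> \<le> \<alpha> * y s + \<beta> * y t"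
      using above_tangent[OF z(1) st(1)] above_tangent[OF z(1) st(3)] w
      by (intro add_mono mult_left_mono) (auto simp: m_def st)
    finally show "Y (\<alpha> *\<^sub>R a + \<beta> *\<^sub>R b) \<le> \<alpha> * Y a + \<beta> * Y b"
      using Y z st by simp
  qed
  ultimately show ?thesis using that S S_def Y by metis
qed

end

section \<open>Symmetries of the equation of motion\<close>

lemma ring_solution_velocity:
  assumes "ring_solution d I r" "t \<in> I"
  shows "(r has_vector_derivative velocity r t) (at t)"
  using assms by (simp add: ring_solution_def velocity_def vector_derivative_works)

lemma ring_solution_cong:
  assumes sol: "ring_solution d I r" and eq: "\<And>t. t \<in> I \<Longrightarrow> s t = r t"
  shows "ring_solution d I s"
proof -
  have "open I" using sol by (simp add: ring_solution_def)
  have ds: "(s has_vector_derivative velocity r t) (at t)" if "t \<in> I" for t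
    using has_vector_derivative_transform_within_open[OF ring_solution_velocity[OF sol that] \<open>open I\<close> that] eq
    by simp
  then have velocity: "velocity s t = velocity r t" if "t \<in> I" for t
    using that by (simp add: velocity_def vector_derivative_at)
  have "(velocity s has_vector_derivative g) (at t)"
    if "(velocity r has_vector_derivative g) (at t)" "t \<in> I" for t g
    using has_vector_derivative_transform_within_open[OF that(1) \<open>open I\<close> that(2)] velocity by simp
  then show ?thesis
    using sol eq ds unfolding ring_solution_def
    by (metis differentiableI_vector)
qed

lemma ring_solution_union:
  assumes "ring_solution d I r" "ring_solution d J r" "I \<inter> J \<noteq> {}"
  shows "ring_solution d (I \<union> J) r"
  using assms unfolding ring_solution_def is_interval_connected_1
  by (auto intro: connected_Un)

lemma has_vector_derivative_mirror_reverse: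
  assumes "(f has_vector_derivative v) (at (a - t))"
  shows "((\<lambda>t. mirror (f (a - t))) has_vector_derivative - mirror v) (at t)"
proof -
  have "((\<lambda>t. a - t) has_vector_derivative - 1) (at t)"
    by (auto intro!: derivative_eq_intros)
  from vector_diff_chain_at[OF this assms]
  have "((\<lambda>t. f (a - t)) has_vector_derivative - v) (at t)" by (simp add: o_def)
  from bounded_linear.has_vector_derivative[OF bounded_linear_mirror this]
  show ?thesis by (simp add: mirror_uminus)
qed

text \<open>
  The reflection preserves the potential and reversing time preserves accelerations, so their
  composition maps solutions to solutions.
\<close>

lemma ring_solution_mirror_reverse:
  assumes sol: "ring_solution d I r" and inside: "\<And>t. t \<in> I \<Longrightarrow> norm (r t) < 1"
  shows "ring_solution d {t. a - t \<in> I} (\<lambda>t. mirror (r (a - t)))"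
proof -
  define s where "s = (\<lambda>t. mirror (r (a - t)))"
  define J where "J = {t. a - t \<in> I}"
  have J: "J = (\<lambda>t. a - t) ` I" by (auto simp: J_def image_iff intro!: bexI[of _ "a - _"])
  have I: "open I" "is_interval I" "I \<noteq> {}" using sol by (auto simp: ring_solution_def)
  have "open J"
    unfolding J_def using open_vimage[OF I(1), of "\<lambda>t. a - t"]
    by (simp add: vimage_def continuous_on_diff)
  moreover have "is_interval J"
    using I unfolding J is_interval_connected_1
    by (intro connected_continuous_image continuous_intros)
  moreover have "J \<noteq> {}" using I J by simp
  moreover have ds: "(s has_vector_derivative - mirror (velocity r (a - t))) (at t)" if "t \<in> J" for t
    unfolding s_def using that J_def
    by (intro has_vector_derivative_mirror_reverse ring_solution_velocity[OF sol]) auto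
  moreover have "s t \<notin> unit_circle" if "t \<in> J" for t
    using that sol by (simp add: s_def J_def ring_solution_def)
  moreover have "\<exists>g. GDERIV (ring_potential d) (s t) :> g \<and> (velocity s has_vector_derivative - g) (at t)"
    if t: "t \<in> J" for t
  proof -
    from t have "a - t \<in> I" by (simp add: J_def)
    with sol obtain g where g: "GDERIV (ring_potential d) (r (a - t)) :> g"
      "(velocity r has_vector_derivative - g) (at (a - t))"
      by (auto simp: ring_solution_def)
    have "((\<lambda>t. - mirror (velocity r (a - t))) has_vector_derivative - mirror g) (at t)"
      using has_vector_derivative_minus[OF has_vector_derivative_mirror_reverse[OF g(2)]]
      by (simp add: mirror_uminus)
    then have "(velocity s has_vector_derivative - mirror g) (at t)"
      by (rule has_vector_derivative_transform_within_open[OF _ \<open>open J\<close> t])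
        (simp add: velocity_def vector_derivative_at[OF ds])
    moreover have "GDERIV (ring_potential d) (s t) :> mirror g"
      unfolding s_def using g(1) inside \<open>a - t \<in> I\<close> by (intro gderiv_ring_potential_mirror) auto
    ultimately show ?thesis by blast
  qed
  ultimately show ?thesis
    unfolding ring_solution_def s_def[symmetric] J_def[symmetric]
    by (auto intro: differentiableI_vector)
qed

section \<open>Orbits in the disc bounded by the ring\<close>

text \<open>
  The hypotheses on a normalized orbit, except for maximality, with the time \<open>t0\<close> of closest
  approach as a parameter.
\<close>

locale ring_orbit =
  fixes d :: real and I :: "real set" and r :: "real \<Rightarrow> real^3" and t0 :: real
  assumes d_pos: "0 < d"
    and solution: "ring_solution d I r"
    and planar: "\<And>t. t \<in> I \<Longrightarrow> r t $ 3 = 0"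
    and inside: "\<And>t. t \<in> I \<Longrightarrow> norm (r t) < 1"
    and rotating: "\<exists>t\<in>I. angular_momentum r t \<noteq> 0"
    and t0: "t0 \<in> I"
    and closest: "\<And>t. t \<in> I \<Longrightarrow> norm (r t0) \<le> norm (r t)"
    and upright: "r t0 $ 1 = 0" "0 < r t0 $ 2"
begin

definition grad :: "real \<Rightarrow> real^3" where
  "grad t = (SOME g. GDERIV (ring_potential d) (r t) :> g \<and> (velocity r has_vector_derivative - g) (at t))"

text \<open>
  The force is this multiple of the position vector.
\<close>

definition stiffness :: "real \<Rightarrow> real" where
  "stiffness t = - (grad t \<bullet> r t) / (norm (r t))\<^sup>2"

lemma I: "open I" "is_interval I"
  using solution by (auto simp: ring_solution_def)

lemma grad:
  assumes "t \<in> I"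
  shows "GDERIV (ring_potential d) (r t) :> grad t" "(velocity r has_vector_derivative - grad t) (at t)"
proof -
  have "\<exists>g. GDERIV (ring_potential d) (r t) :> g \<and> (velocity r has_vector_derivative - g) (at t)"
    using solution assms by (auto simp: ring_solution_def)
  from someI_ex[OF this] show "GDERIV (ring_potential d) (r t) :> grad t"
    "(velocity r has_vector_derivative - grad t) (at t)"
    by (auto simp: grad_def)
qed

lemma norm_square: "(norm (r t))\<^sup>2 = (r t $ 1)\<^sup>2 + (r t $ 2)\<^sup>2" if "t \<in> I"
  using planar[OF that] by (simp add: norm_vector_3)

lemma norm_pos: "0 < norm (r t)" if "t \<in> I"
proof -
  have "r t0 \<noteq> 0" using upright by auto
  then show ?thesis using closest[OF that] by (meson less_le_trans zero_less_norm_iff)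
qed

lemma velocity_planar: "velocity r t $ 3 = 0" if "t \<in> I"
proof -
  have "((\<lambda>t. r t $ 3) has_vector_derivative velocity r t $ 3) (at t)"
    by (rule bounded_linear.has_vector_derivative[OF bounded_linear_vec_nth ring_solution_velocity[OF solution that]])
  then have "((\<lambda>t. 0) has_vector_derivative velocity r t $ 3) (at t)"
    by (rule has_vector_derivative_transform_within_open[OF _ I(1) that]) (simp add: planar)
  then show ?thesis
    using vector_derivative_unique_at has_vector_derivative_const by blast
qed

lemma grad_eq: "- grad t $ 1 = stiffness t * r t $ 1" "- grad t $ 2 = stiffness t * r t $ 2" if t: "t \<in> I"
proof -
  have c: "grad t $ 2 * r t $ 1 = grad t $ 1 * r t $ 2"
    using ring_force_is_central[OF grad(1)] inside planar t by blast
  have i: "grad t \<bullet> r t = grad t $ 1 * r t $ 1 + grad t $ 2 * r t $ 2"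
    using planar[OF t] by (simp add: inner_vec_def sum_3)
  have "(norm (r t))\<^sup>2 * grad t $ 1 = (grad t \<bullet> r t) * r t $ 1"
    "(norm (r t))\<^sup>2 * grad t $ 2 = (grad t \<bullet> r t) * r t $ 2"
    unfolding norm_square[OF t] i using c by algebra+
  then show "- grad t $ 1 = stiffness t * r t $ 1" "- grad t $ 2 = stiffness t * r t $ 2"
    using norm_pos[OF t] by (simp_all add: stiffness_def field_simps)
qed

sublocale central_motion I "\<lambda>t. r t $ 1" "\<lambda>t. r t $ 2" "\<lambda>t. velocity r t $ 1" "\<lambda>t. velocity r t $ 2" stiffness
proof
  fix t assume t: "t \<in> I"
  have "((\<lambda>t. r t $ i) has_real_derivative velocity r t $ i) (at t)" for i
    using bounded_linear.has_vector_derivative[OF bounded_linear_vec_nth ring_solution_velocity[OF solution t]]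
    by (simp add: has_real_derivative_iff_has_vector_derivative)
  then show "((\<lambda>t. r t $ 1) has_real_derivative velocity r t $ 1) (at t)"
    "((\<lambda>t. r t $ 2) has_real_derivative velocity r t $ 2) (at t)" by auto
  have "((\<lambda>t. velocity r t $ i) has_real_derivative - grad t $ i) (at t)" for i
    using bounded_linear.has_vector_derivative[OF bounded_linear_vec_nth grad(2)[OF t]]
    by (simp add: has_real_derivative_iff_has_vector_derivative)
  then show "((\<lambda>t. velocity r t $ 1) has_real_derivative stiffness t * r t $ 1) (at t)"
    "((\<lambda>t. velocity r t $ 2) has_real_derivative stiffness t * r t $ 2) (at t)"
    using grad_eq[OF t] by metis+
qed (rule I)

sublocale repulsive_motion I "\<lambda>t. r t $ 1" "\<lambda>t. r t $ 2" "\<lambda>t. velocity r t $ 1" "\<lambda>t. velocity r t $ 2" stiffness t0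
proof
  show "0 \<le> stiffness t" if "t \<in> I" for t
    using ring_force_is_outward[OF grad(1)[OF that] inside[OF that] planar[OF that]] d_pos
    by (simp add: stiffness_def divide_nonpos_nonneg)
  show "t0 \<in> I" by (rule t0)
  show "r t0 $ 1 = 0" "0 < r t0 $ 2" by (rule upright)+
  \<comment> \<open>The velocity is orthogonal to the position at the closest point, hence horizontal there;
    and it is nonzero because the angular momentum is.\<close>
  have "((\<lambda>t. (r t $ 1)\<^sup>2 + (r t $ 2)\<^sup>2) has_real_derivative 2 * (r t0 $ 2 * velocity r t0 $ 2)) (at t0)"
    using dx[OF t0] dy[OF t0] upright by (auto intro!: derivative_eq_intros)
  moreover obtain e where "0 < e" "ball t0 e \<subseteq> I"
    using I(1) t0 by (meson open_contains_ball)
  moreover have "(r t0 $ 1)\<^sup>2 + (r t0 $ 2)\<^sup>2 \<le> (r t $ 1)\<^sup>2 + (r t $ 2)\<^sup>2" if "t \<in> I" for t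
    using closest[OF that] t0 that by (simp flip: norm_square)
  ultimately have "2 * (r t0 $ 2 * velocity r t0 $ 2) = 0"
    by (intro DERIV_local_min[of _ _ t0 e]) (auto simp: subset_iff dist_real_def)
  then show v2: "velocity r t0 $ 2 = 0" using upright by simp
  show "velocity r t0 $ 1 \<noteq> 0"
    using rotating angular_momentum_const[OF t0] upright v2 by (auto simp: angular_momentum_def)
qed

definition energy :: "real \<Rightarrow> real" where
  "energy t = (velocity r t \<bullet> velocity r t) / 2 + ring_potential d (r t)"

lemma energy_const:
  assumes "s \<in> I" "t \<in> I"
  shows "energy t = energy s"
proof (rule zero_derivative_imp_constant[OF I(2) assms])
  fix t assume t: "t \<in> I"
  have "((\<lambda>t. velocity r t \<bullet> velocity r t) has_vector_derivative - 2 * (grad t \<bullet> velocity r t)) (at t)"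
    using bounded_bilinear.has_vector_derivative[OF bounded_bilinear_inner grad(2)[OF t] grad(2)[OF t]]
    by (simp add: inner_commute)
  moreover have "((\<lambda>t. ring_potential d (r t)) has_real_derivative grad t \<bullet> velocity r t) (at t)"
    by (rule gderiv_along_curve[OF grad(1)[OF t] ring_solution_velocity[OF solution t]])
  ultimately show "(energy has_real_derivative 0) (at t)"
    unfolding energy_def[abs_def] has_real_derivative_iff_has_vector_derivative[symmetric]
    by (auto intro!: derivative_eq_intros)
qed

text \<open>
  By Lagrange's identity \<open>q\<^sup>2 = |r|\<^sup>2 |r'|\<^sup>2 - K\<^sup>2\<close>. The angular momentum \<open>K\<close> is constant, and \<open>|r'|\<^sup>2\<close> is
  determined by the energy and the potential, which in turn depends on the distance only.
\<close>

lemma radial_speed_determined_by_radius: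
  "\<forall>s\<in>I. \<forall>t\<in>I. u s = u t \<longrightarrow> (q s)\<^sup>2 = (q t)\<^sup>2"
proof (intro ballI impI)
  fix s t assume st: "s \<in> I" "t \<in> I" and u: "u s = u t"
  have radial_square: "(q t)\<^sup>2 = u t * (velocity r t \<bullet> velocity r t) - (velocity r t0 $ 1 * r t0 $ 2)\<^sup>2"
    if "t \<in> I" for t
  proof -
    have "velocity r t \<bullet> velocity r t = (velocity r t $ 1)\<^sup>2 + (velocity r t $ 2)\<^sup>2"
      using velocity_planar[OF that] by (simp add: inner_vec_def sum_3 power2_eq_square)
    then show ?thesis
      using angular_momentum_eq[OF that] unfolding u_def q_def by algebra
  qed
  have "norm (r t) = norm (r s)"
    by (rule power2_eq_imp_eq[OF _ norm_ge_zero norm_ge_zero])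
      (use u in \<open>simp add: u_def norm_square st\<close>)
  then have "ring_potential d (r s) = ring_potential d (r t)"
    using st by (intro ring_potential_rotation_invariant inside planar)
  then have "velocity r s \<bullet> velocity r s = velocity r t \<bullet> velocity r t"
    using energy_const[OF st] by (simp add: energy_def)
  then show "(q s)\<^sup>2 = (q t)\<^sup>2"
    using u by (simp add: radial_square st)
qed

lemma mirror_reverse:
  assumes "t \<in> I" "2 * t0 - t \<in> I"
  shows "mirror (r (2 * t0 - t)) = r t"
  using motion_even[OF radial_speed_determined_by_radius, of "t - t0"] assms planar
  by (simp add: vec_eq_iff forall_3 algebra_simps)

text \<open>
  The orbit and its time-reversed mirror image agree where both are defined. Glued together they
  solve the equation of motion on the union of \<open>I\<close> and its reflection in \<open>t0\<close>, so a maximal \<open>I\<close>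
  contains this reflection.
\<close>

lemma maximal_imp_symmetric_interval:
  assumes max: "\<And>J s. ring_solution d J s \<Longrightarrow> I \<subseteq> J \<Longrightarrow> (\<And>t. t \<in> I \<Longrightarrow> s t = r t) \<Longrightarrow> J = I"
    and t: "t \<in> I"
  shows "2 * t0 - t \<in> I"
proof -
  define J where "J = {t. 2 * t0 - t \<in> I}"
  define s where "s = (\<lambda>t. if t \<in> I then r t else mirror (r (2 * t0 - t)))"
  have "ring_solution d I s"
    by (rule ring_solution_cong[OF solution]) (simp add: s_def)
  moreover have "ring_solution d J s"
    unfolding J_def
    by (rule ring_solution_cong[OF ring_solution_mirror_reverse[OF solution inside]])
      (auto simp: s_def mirror_reverse)
  moreover have "t0 \<in> I \<inter> J" using t0 by (simp add: J_def)
  ultimately have "ring_solution d (I \<union> J) s" by (intro ring_solution_union) auto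
  then have "I \<union> J = I" by (rule max) (auto simp: s_def)
  moreover have "2 * t0 - t \<in> J" using t by (simp add: J_def)
  ultimately show ?thesis by blast
qed

end

theorem proposition2:
  fixes dens :: real and I :: "real set" and r :: "real \<Rightarrow> real^3"
  assumes "dens > 0"
    and "maximal_ring_solution dens I r"
    and "\<forall>t\<in>I. r t $ 3 = 0"
    and "\<forall>t\<in>I. norm (r t) < 1"
    and "\<exists>t\<in>I. angular_momentum r t \<noteq> 0"
    and "normalized I r"
  shows "\<exists>(S :: real set) (y :: real \<Rightarrow> real).
           is_interval S \<and> even_on S y \<and> convex_on S y \<and>
           r ` I = {vector [x, y x, 0] | x. x \<in> S}"
proof -
  obtain t0 where t0: "is_arg_min (\<lambda>t. norm (r t)) (\<lambda>t. t \<in> I) t0" "r t0 $ 1 = 0" "r t0 $ 2 > 0"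
    using assms(6) by (auto simp: normalized_def)
  interpret ring_orbit dens I r t0
    using assms t0
    by unfold_locales (auto simp: maximal_ring_solution_def is_arg_min_linorder)
  obtain S Y where SY: "is_interval S" "even_on S Y" "convex_on S Y"
    and S: "S = (\<lambda>t. r t $ 1) ` I" and Y: "\<And>t. t \<in> I \<Longrightarrow> r t $ 2 = Y (r t $ 1)"
  proof (rule trace_is_even_convex_graph[OF radial_speed_determined_by_radius])
    have "J = I" if "ring_solution dens J s" "I \<subseteq> J" "\<And>t. t \<in> I \<Longrightarrow> s t = r t" for J s
      using assms(2) that unfolding maximal_ring_solution_def by blast
    then show "2 * t0 - t \<in> I" if "t \<in> I" for t
      using that by (rule maximal_imp_symmetric_interval)
  qed blast
  have point: "r t = vector [r t $ 1, Y (r t $ 1), 0]" if "t \<in> I" for t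
    using Y[OF that] planar[OF that] by (simp add: vec_eq_iff forall_3)
  then have "r ` I = {vector [x, Y x, 0] | x. x \<in> S}"
    unfolding S by (auto simp: image_iff)
  with SY show ?thesis by blast
qed

end
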